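(* Let $X,Y$ be compact Hausdorff spaces and let $E,F$ be Banach spaces over $\mathbb{K}$, where $F$ is strictly convex. Let $A,B$ be $\mathbb{K}$-linear subspaces of $C(X,E)$ and $C(Y,F)$, respectively, and let $T:A\to B$ be a surjective (not necessarily linear) isometry. Then there exist a subset $Y_0$ of $Y$, a continuous surjection $\Phi:Y_0\to\Theta(\overline{A})$ and a family $\{V_y\}_{y\in Y_0}$ of real-linear operators from $E$ to $F$ with $\|V_y\|=1$ for all $y\in Y_0$ such that $$Tf(y)=T0(y)+V_y(f(\Phi(y)))\qquad (f\in A,\ y\in Y_0).$$ Furthermore: (i) if $A$ contains constants, then the map $y\mapsto V_y$ from $Y_0$ to $B(E,F)$ is continuous with respect to the strong operator topology on $B(E,F)$; (ii) if $A$ and $B$ contain constants and $T$ maps each constant function to a constant function, then all the $V_y$ are equal to a single real-linear isometry $V:E\to F$.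
   Context: $\mathbb{K}$ denotes $\mathbb{R}$ or $\mathbb{C}$. Compact Hausdorff spaces are nonempty and Banach spaces are nonzero. $C(X,E)$ is the Banach space of continuous $E$-valued functions on $X$ with the supremum norm $\|f\|_\infty=\sup_{x\in X}\|f(x)\|$, and $\overline{A}$ is the closure of $A$ in $C(X,E)$. An isometry is a map with $\|Tf-Tg\|_\infty=\|f-g\|_\infty$ for all $f,g\in A$. $S(E)$ is the unit sphere $\{u\in E:\|u\|=1\}$. For a $\mathbb{K}$-subspace $D$ of $C(X,E)$, a point $x\in X$ is a strong boundary point of $D$ if for each neighborhood $U$ of $x$, each $\epsilon>0$ and each $u\in S(E)$ there is $f\in D$ with $\|f\|_\infty=1$, $f(x)=u$ and $\|f(z)\|<\epsilon$ for all $z\in X\setminus U$; $\Theta(D)$ is the set of all strong boundary points of $D$. "$A$ contains constants" means that for every $u\in E$ the constant function $c_u$ (with $c_u(x)=u$ for all $x\in X$) is in $A$; similarly for $B$. $B(E,F)$ is the space of bounded real-linear operators from $E$ to $F$, and the strong operator topology is the topology of pointwise norm convergence on $E$. *)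

theory Defs
  imports "HOL-Analysis.Analysis"
begin

section \<open>Scalars and vector spaces over them\<close>

text \<open>
  The field \<open>K\<close> of real or of complex numbers: isometrically isomorphic, as a real algebra, to one
  of the subfields \<open>\<real>\<close> and \<open>UNIV\<close> of the complex numbers.
\<close>

class real_or_complex = real_normed_field +
  assumes real_or_complex:
    "\<exists>h::'a \<Rightarrow> complex. inj h \<and> (range h = \<real> \<or> range h = UNIV)
       \<and> (\<forall>a b. h (a + b) = h a + h b)
       \<and> (\<forall>a b. h (a * b) = h a * h b)
       \<and> (\<forall>r a. h (r *\<^sub>R a) = r *\<^sub>R h a)
       \<and> (\<forall>a. cmod (h a) = norm a)"

instance real :: real_or_complex
  by standard (rule exI[of _ complex_of_real], simp add: inj_on_def Reals_def scaleR_conv_of_real)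

instance complex :: real_or_complex
  by standard (rule exI[of _ "\<lambda>z. z"], simp)

text \<open>
  The library's normed spaces are real. A normed space over \<open>K\<close> is a real normed space
  together with a scalar multiplication by \<open>K\<close> that extends the real one and for which the norm
  is homogeneous.
\<close>

locale normed_space_over = vector_space scl
  for scl :: "'k::real_or_complex \<Rightarrow> 'e::real_normed_vector \<Rightarrow> 'e" +
  assumes scale_of_real: "scl (of_real r) x = r *\<^sub>R x"
    and norm_scale: "norm (scl c x) = norm c * norm x"
begin

lemma bounded_linear_scale: "bounded_linear (scl c)"
proof (rule bounded_linear_intro[where K = "norm c"])
  show "scl c (r *\<^sub>R x) = r *\<^sub>R scl c x" for r x
    by (simp add: mult.commute flip: scale_of_real)
  show "scl c (x + y) = scl c x + scl c y" for x y
    by (rule scale_right_distrib)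
  show "norm (scl c x) \<le> norm x * norm c" for x
    by (simp add: norm_scale mult.commute)
qed

end

text \<open>Pointwise scalar multiplication on \<open>C(X,E)\<close>; the library only provides the real one.\<close>

definition bcontfun_scale ::
  "('k \<Rightarrow> 'e \<Rightarrow> 'e) \<Rightarrow> 'k \<Rightarrow> ('x::topological_space \<Rightarrow>\<^sub>C 'e::real_normed_vector) \<Rightarrow> ('x \<Rightarrow>\<^sub>C 'e)" where
  "bcontfun_scale scl c f = Bcontfun (\<lambda>x. scl c (apply_bcontfun f x))"

context normed_space_over
begin

lemma apply_bcontfun_scale:
  "apply_bcontfun (bcontfun_scale scl c f) x = scl c (apply_bcontfun f x)"
proof -
  have "bounded (scl c ` range (apply_bcontfun f))"
    by (intro bounded_linear_image bounded_linear_scale) simp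
  moreover have "continuous_on UNIV (\<lambda>x. scl c (apply_bcontfun f x))"
    by (intro bounded_linear.continuous_on[OF bounded_linear_scale]) simp
  ultimately have "(\<lambda>x. scl c (apply_bcontfun f x)) \<in> bcontfun"
    by (simp add: bcontfun_def image_image)
  then show ?thesis
    by (simp add: bcontfun_scale_def Bcontfun_inverse)
qed

lemma vector_space_bcontfun_scale: "vector_space (bcontfun_scale scl)"
  by unfold_locales
    (auto intro!: bcontfun_eqI
      simp: apply_bcontfun_scale plus_bcontfun.rep_eq scale_right_distrib scale_left_distrib)

end

section \<open>Strict convexity and strong boundary points\<close>

definition strictly_convex_space :: "'f::real_normed_vector itself \<Rightarrow> bool" where
  "strictly_convex_space _ \<longleftrightarrow>
     (\<forall>u v::'f. norm u = 1 \<longrightarrow> norm v = 1 \<longrightarrow> u \<noteq> v \<longrightarrow> norm ((1/2) *\<^sub>R (u + v)) < 1)"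

definition strong_boundary_point ::
  "('x::topological_space \<Rightarrow>\<^sub>C 'e::real_normed_vector) set \<Rightarrow> 'x \<Rightarrow> bool" where
  "strong_boundary_point D x \<longleftrightarrow>
     (\<forall>U e u. open U \<longrightarrow> x \<in> U \<longrightarrow> e > 0 \<longrightarrow> norm u = 1 \<longrightarrow>
       (\<exists>f\<in>D. norm f = 1 \<and> apply_bcontfun f x = u
          \<and> (\<forall>z. z \<notin> U \<longrightarrow> norm (apply_bcontfun f z) < e)))"

definition strong_boundary ::
  "('x::topological_space \<Rightarrow>\<^sub>C 'e::real_normed_vector) set \<Rightarrow> 'x set" where
  "strong_boundary D = {x. strong_boundary_point D x}"

definition contains_constants ::
  "('x::topological_space \<Rightarrow>\<^sub>C 'e::real_normed_vector) set \<Rightarrow> bool" where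
  "contains_constants D \<longleftrightarrow> (\<forall>u. const_bcontfun u \<in> D)"

end

theory Submission
  imports Defs
begin

text \<open>
  By the Mazur--Ulam theorem \<open>f \<mapsto> T f - T 0\<close> is real-linear, so it extends to a linear isometry \<open>S\<close> on
  the closure \<open>D\<close> of \<open>A\<close>. For a strong boundary point \<open>x\<close> and a unit vector \<open>u\<close>, averaging and
  compactness give a point \<open>y\<close> at which \<open>S f\<close> attains its norm for all \<open>f \<in> D\<close> in the unit ball with
  \<open>f x = u\<close>, and strict convexity makes the value \<open>S f y\<close> the same for all of them. If \<open>f \<in> D\<close>
  vanishes at \<open>x\<close>, a Bishop-type peak lemma (which needs \<open>D\<close> to be closed) provides an \<open>h\<close> such that,
  up to scaling \<open>f\<close>, both \<open>h\<close> and \<open>h + f / 4\<close> are such functions; hence \<open>S f y = 0\<close>. So \<open>S f y\<close>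
  depends on \<open>f x\<close> only, and this dependence is \<open>V\<^sub>y\<close>.
\<close>

section \<open>The Mazur--Ulam theorem\<close>

text \<open>Surjectivity onto \<open>B\<close> is built in because the arguments below use the
  inverse \<open>inv_into A f\<close> as an isometry from \<open>B\<close> onto
  \<open>A\<close>.\<close>

definition isometry_betw :: "('a::metric_space \<Rightarrow> 'b::metric_space) \<Rightarrow> 'a set \<Rightarrow> 'b set \<Rightarrow> bool" where
  "isometry_betw f A B \<longleftrightarrow> f ` A = B \<and> (\<forall>x\<in>A. \<forall>y\<in>A. dist (f x) (f y) = dist x y)"

lemma isometry_betw_dist: "isometry_betw f A B \<Longrightarrow> x \<in> A \<Longrightarrow> y \<in> A \<Longrightarrow> dist (f x) (f y) = dist x y"
  by (simp add: isometry_betw_def)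

lemma isometry_betw_mem: "isometry_betw f A B \<Longrightarrow> x \<in> A \<Longrightarrow> f x \<in> B"
  by (auto simp: isometry_betw_def)

lemma isometry_betw_inj_on: "isometry_betw f A B \<Longrightarrow> inj_on f A"
  unfolding isometry_betw_def by (metis dist_eq_0_iff inj_onI)

lemma isometry_betw_comp:
  "isometry_betw f A B \<Longrightarrow> isometry_betw g B C \<Longrightarrow> isometry_betw (g \<circ> f) A C"
  by (auto simp: isometry_betw_def)

lemma isometry_betw_inv_into:
  assumes "isometry_betw f A B"
  shows "isometry_betw (inv_into A f) B A"
proof -
  have f: "f ` A = B" "\<And>x y. x \<in> A \<Longrightarrow> y \<in> A \<Longrightarrow> dist (f x) (f y) = dist x y"
    using assms by (auto simp: isometry_betw_def)
  have "inv_into A f ` f ` A = A"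
    using isometry_betw_inj_on[OF assms] by (rule inv_into_image_cancel) simp
  moreover have "dist (inv_into A f x) (inv_into A f y) = dist x y" if "x \<in> B" "y \<in> B" for x y
    using f(2)[of "inv_into A f x" "inv_into A f y"] that f(1)
    by (simp add: inv_into_into f_inv_into_f)
  ultimately show ?thesis
    using f(1) by (auto simp: isometry_betw_def)
qed

section \<open>Point reflections and their fixed points\<close>

lemma isometry_betw_reflection:
  fixes A :: "'a::real_normed_vector set"
  assumes "subspace A" "a \<in> A" "b \<in> A"
  shows "isometry_betw (\<lambda>x. a + b - x) A A"
proof -
  have mem: "a + b - x \<in> A" if "x \<in> A" for x
    using assms that by (simp add: subspace_add subspace_diff)
  have "(\<lambda>x. a + b - x) ` A = A"
  proof
    show "A \<subseteq> (\<lambda>x. a + b - x) ` A"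
    proof
      fix x assume "x \<in> A"
      then show "x \<in> (\<lambda>x. a + b - x) ` A"
        by (intro image_eqI[of _ _ "a + b - x"]) (simp_all add: mem)
    qed
  qed (use mem in auto)
  then show ?thesis
    by (auto simp: isometry_betw_def dist_norm norm_minus_commute)
qed

lemma subspace_midpoint: "subspace A \<Longrightarrow> a \<in> A \<Longrightarrow> b \<in> A \<Longrightarrow> midpoint a b \<in> A"
  by (simp add: midpoint_def subspace_add subspace_scale)

lemma reflection_midpoint: "a + b - midpoint a b = midpoint a b"
proof -
  have "midpoint a b + midpoint a b = a + b"
    by (simp add: midpoint_def flip: scaleR_2)
  then show ?thesis
    by (simp add: algebra_simps)
qed

lemma dist_reflection_midpoint:
  fixes a b x :: "'a::real_normed_vector"
  shows "dist (a + b - x) x = 2 * dist x (midpoint a b)"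
proof -
  have "a + b - x - x = 2 *\<^sub>R (midpoint a b - x)"
    by (simp add: midpoint_def algebra_simps scaleR_2)
  then have "dist (a + b - x) x = norm (2 *\<^sub>R (midpoint a b - x))"
    by (simp only: dist_norm)
  then show ?thesis
    by (simp add: dist_norm norm_minus_commute)
qed

text \<open>
  The commutator of the isometry with the reflection in the midpoint again fixes both endpoints and
  moves the midpoint twice as far, whereas that distance is at most twice the one from the midpoint
  to an endpoint (Vaisala).
\<close>
lemma isometry_fixes_midpoint:
  fixes A :: "'a::real_normed_vector set"
  assumes "subspace A" "a \<in> A" "b \<in> A"
    and "isometry_betw g A A" "g a = a" "g b = b"
  shows "g (midpoint a b) = midpoint a b"
proof -
  define z where "z = midpoint a b"
  let ?r = "\<lambda>x. a + b - x"
  have z: "z \<in> A" "?r z = z"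
    by (simp_all add: z_def reflection_midpoint subspace_midpoint assms)
  have refl: "isometry_betw ?r A A"
    using assms by (simp add: isometry_betw_reflection)
  \<comment> \<open>The bound is claimed for all such isometries at once: the induction step applies
    it to the commutator \<open>k\<close>, which moves \<open>z\<close> twice as far as
    \<open>g\<close> does.\<close>
  have "dist (g z) z \<le> 2 * dist a z / 2 ^ n"
    if "isometry_betw g A A" "g a = a" "g b = b" for n g
    using that
  proof (induction n arbitrary: g)
    case 0
    have "dist (g z) z \<le> dist (g z) (g a) + dist a z"
      using dist_triangle[of "g z" z a] 0 by simp
    also have "dist (g z) (g a) = dist a z"
      using 0 isometry_betw_dist z assms by (metis dist_commute)
    finally show ?case by simp
  next
    case (Suc n)
    let ?h = "inv_into A g"
    define k where "k = (?r \<circ> ?h) \<circ> (?r \<circ> g)"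
    have inj: "inj_on g A" and h: "isometry_betw ?h A A"
      using Suc.prems isometry_betw_inj_on isometry_betw_inv_into by blast+
    have "?h a = a" "?h b = b"
      using inj Suc.prems assms inv_into_f_f by metis+
    then have "k a = a" "k b = b"
      using Suc.prems by (auto simp: k_def)
    moreover have "isometry_betw k A A"
      unfolding k_def using isometry_betw_comp refl h Suc.prems by metis
    ultimately have "dist (k z) z \<le> 2 * dist a z / 2 ^ n"
      by (rule Suc.IH[rotated])
    moreover have "dist (k z) z = 2 * dist (g z) z"
    proof -
      have gz: "g z \<in> A" "?r (g z) \<in> A"
        using Suc.prems z refl isometry_betw_mem by metis+
      have "dist (k z) z = dist (?r (?h (?r (g z)))) (?r z)"
        using z by (simp add: k_def)
      also have "\<dots> = dist (?h (?r (g z))) z"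
        using isometry_betw_dist[OF refl] gz h z isometry_betw_mem by metis
      also have "\<dots> = dist (?h (?r (g z))) (?h (g z))"
        using inj z inv_into_f_f by metis
      also have "\<dots> = dist (?r (g z)) (g z)"
        using h gz isometry_betw_dist by metis
      finally show ?thesis
        by (simp add: dist_reflection_midpoint z_def)
    qed
    ultimately show ?case by (simp add: field_simps)
  qed
  then have "dist (g z) z \<le> 2 * dist a z / 2 ^ n" for n
    using assms by blast
  moreover have "(\<lambda>n. 2 * dist a z / 2 ^ n) \<longlonglongrightarrow> 0"
    using LIMSEQ_divide_realpow_zero[of 2] by simp
  ultimately have "dist (g z) z \<le> 0"
    using LIMSEQ_le_const by blast
  then show ?thesis by (simp add: z_def)
qed

text \<open>The composite \<open>?k\<close> fixes \<open>a\<close> and \<open>b\<close>, since each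
  reflection swaps its two endpoints, so it fixes their midpoint. Unwinding this, the reflection
  \<open>?s\<close> fixes the image of the midpoint, and the only fixed point of a point reflection
  is its center.\<close>

lemma isometry_midpoint:
  fixes A :: "'a::real_normed_vector set" and B :: "'b::real_normed_vector set"
  assumes "subspace A" "subspace B" "isometry_betw f A B" "a \<in> A" "b \<in> A"
  shows "f (midpoint a b) = midpoint (f a) (f b)"
proof -
  let ?r = "\<lambda>x. a + b - x" and ?s = "\<lambda>y. f a + f b - y" and ?h = "inv_into A f"
  let ?k = "(?r \<circ> ?h) \<circ> (?s \<circ> f)" and ?z = "midpoint a b"
  have inj: "inj_on f A" and h: "isometry_betw ?h B A"
    using assms isometry_betw_inj_on isometry_betw_inv_into by blast+
  have f: "f a \<in> B" "f b \<in> B" "f ?z \<in> B" "?z \<in> A"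
    using assms isometry_betw_mem subspace_midpoint by metis+
  have refl: "isometry_betw ?r A A" "isometry_betw ?s B B"
    using assms f by (simp_all add: isometry_betw_reflection)
  have "isometry_betw ?k A A"
    using isometry_betw_comp refl h assms by metis
  moreover have "?k a = a" "?k b = b"
    using inj assms by (auto simp: inv_into_f_f)
  ultimately have "?k ?z = ?z"
    using assms by (intro isometry_fixes_midpoint)
  then have "?h (?s (f ?z)) = ?z"
    using reflection_midpoint[of a b] by (simp add: algebra_simps)
  moreover have "?s (f ?z) \<in> f ` A"
    using isometry_betw_mem[OF refl(2)] f assms by (auto simp: isometry_betw_def)
  ultimately have "?s (f ?z) = f ?z"
    by (metis f_inv_into_f)
  then show ?thesis
    using dist_reflection_midpoint[of "f a" "f b" "f ?z"] by simp
qed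

text \<open>Cauchy's functional equation: additivity gives homogeneity over the rationals, and by
  continuity the set of admissible real factors is closed.\<close>

lemma additive_imp_scaleR_on:
  fixes S :: "'a::real_normed_vector \<Rightarrow> 'b::real_normed_vector"
  assumes A: "subspace A" and S: "continuous_on A S"
    and add: "\<And>x y. x \<in> A \<Longrightarrow> y \<in> A \<Longrightarrow> S (x + y) = S x + S y"
    and x: "x \<in> A"
  shows "S (c *\<^sub>R x) = c *\<^sub>R S x"
proof -
  have mem: "r *\<^sub>R x \<in> A" for r
    using A x by (rule subspace_scale)
  have S0: "S 0 = 0"
    using add[of 0 0] subspace_0[OF A] by simp
  have neg: "S (- y) = - S y" if "y \<in> A" for y
    using add[of y "- y"] subspace_neg[OF A that] that S0 by (simp add: eq_neg_iff_add_eq_0 add.commute)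
  have nat: "S (of_nat n *\<^sub>R y) = of_nat n *\<^sub>R S y" if "y \<in> A" for n y
  proof (induction n)
    case (Suc n)
    then show ?case
      using add[of y "of_nat n *\<^sub>R y"] that subspace_scale[OF A that]
      by (simp add: scaleR_left_distrib)
  qed (simp add: S0)
  have int: "S (of_int k *\<^sub>R y) = of_int k *\<^sub>R S y" if "y \<in> A" for k y
    by (cases k rule: int_cases2)
      (use nat[OF that] neg subspace_scale[OF A that] in \<open>simp_all\<close>)
  have rat: "S (q *\<^sub>R x) = q *\<^sub>R S x" if "q \<in> \<rat>" for q
  proof -
    obtain a b :: int where q: "b > 0" "q = of_int a / of_int b"
      using \<open>q \<in> \<rat>\<close> by (meson Rats_cases')
    \<comment> \<open>Multiplying by the denominator leaves only integer factors.\<close>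
    have "of_int b *\<^sub>R S (q *\<^sub>R x) = S ((of_int b * q) *\<^sub>R x)"
      using int[OF mem] by simp
    also have "\<dots> = of_int b *\<^sub>R q *\<^sub>R S x"
      using int[OF x, of a] q by simp
    finally show ?thesis using q by (metis less_irrefl of_int_0_less_iff scaleR_left_imp_eq)
  qed
  have "continuous_on UNIV (\<lambda>r. S (r *\<^sub>R x))"
    by (rule continuous_on_compose2[OF S]) (auto intro!: continuous_intros mem)
  then have "closed {r. S (r *\<^sub>R x) = r *\<^sub>R S x}"
    by (intro closed_Collect_eq continuous_intros)
  then have "closure \<rat> \<subseteq> {r. S (r *\<^sub>R x) = r *\<^sub>R S x}"
    using rat by (intro closure_minimal) auto
  then show ?thesis
    by (auto simp: Rats_closure_real)
qed

text \<open>The midpoint of \<open>x\<close> and \<open>y\<close> is also the midpoint of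
  \<open>x + y\<close> and 0; comparing its two images gives additivity, and an isometry is
  continuous.\<close>

theorem Mazur_Ulam:
  fixes A :: "'a::real_normed_vector set" and B :: "'b::real_normed_vector set"
  assumes "subspace A" "subspace B" "isometry_betw S A B" "S 0 = 0"
  shows "x \<in> A \<Longrightarrow> y \<in> A \<Longrightarrow> S (x + y) = S x + S y"
    and "x \<in> A \<Longrightarrow> S (c *\<^sub>R x) = c *\<^sub>R S x"
proof -
  have half: "S (midpoint x 0) = midpoint (S x) 0" if "x \<in> A" for x
    using isometry_midpoint[OF assms(1-3) that subspace_0[OF assms(1)]] assms(4)
    by simp
  show add: "S (x + y) = S x + S y" if "x \<in> A" "y \<in> A" for x y
    using isometry_midpoint[OF assms(1-3) that] half[of "x + y"] subspace_add[OF assms(1) that]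
    by (simp add: midpoint_def)
  have "continuous_on A S"
    unfolding continuous_on_iff using isometry_betw_dist[OF assms(3)] by auto
  from additive_imp_scaleR_on[OF assms(1) this add]
  show "S (c *\<^sub>R x) = c *\<^sub>R S x" if "x \<in> A"
    using that by blast
qed

section \<open>Extension to the closure\<close>

lemma subspace_closure:
  fixes A :: "'a::real_normed_vector set"
  assumes A: "subspace A"
  shows "subspace (closure A)"
proof (rule subspaceI)
  show "0 \<in> closure A"
    using subspace_0[OF A] closure_subset by blast
next
  fix x y assume "x \<in> closure A" "y \<in> closure A"
  then obtain u v where "\<And>n. u n \<in> A" "u \<longlonglongrightarrow> x" and "\<And>n. v n \<in> A" "v \<longlonglongrightarrow> y"
    unfolding closure_sequential by blast
  then show "x + y \<in> closure A"
    unfolding closure_sequential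
    by (intro exI[of _ "\<lambda>n. u n + v n"]) (simp add: tendsto_add subspace_add[OF A])
next
  fix x c assume "x \<in> closure A"
  then obtain u where "\<And>n. u n \<in> A" "u \<longlonglongrightarrow> x"
    unfolding closure_sequential by blast
  then show "c *\<^sub>R x \<in> closure A"
    unfolding closure_sequential
    by (intro exI[of _ "\<lambda>n. c *\<^sub>R u n"]) (simp add: tendsto_scaleR subspace_scale[OF A])
qed

text \<open>
  The library has the following instances only for metric domains, which is too special for
  compact Hausdorff spaces.
\<close>
instance bcontfun :: (topological_space, complete_space) complete_space
proof
  fix f :: "nat \<Rightarrow> 'a \<Rightarrow>\<^sub>C 'b"
  assume "Cauchy f"
  then obtain g where g: "uniform_limit UNIV f g sequentially"
    using uniformly_convergent_eq_cauchy[of "\<lambda>_. True" f]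
    unfolding Cauchy_def uniform_limit_sequentially_iff
    by (metis dist_fun_lt_imp_dist_val_lt)
  obtain h where "f \<longlonglongrightarrow> h"
    using uniform_limit_bcontfunE[OF g sequentially_bot] by metis
  then show "convergent f"
    by (rule convergentI)
qed

instance bcontfun :: (topological_space, banach) banach ..

text \<open>A linear norm-preserving map is uniformly continuous, so it extends to the closure by
  completeness of the codomain. The algebraic identities and the norm pass to limits of
  sequences.\<close>

lemma linear_isometry_extend_closure:
  fixes S :: "'a::real_normed_vector \<Rightarrow> 'b::banach"
  assumes A: "subspace A"
    and add: "\<And>x y. x \<in> A \<Longrightarrow> y \<in> A \<Longrightarrow> S (x + y) = S x + S y"
    and scale: "\<And>c x. x \<in> A \<Longrightarrow> S (c *\<^sub>R x) = c *\<^sub>R S x"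
    and norm: "\<And>x. x \<in> A \<Longrightarrow> norm (S x) = norm x"
  obtains S' where "\<And>x. x \<in> A \<Longrightarrow> S' x = S x"
    and "\<And>x y. x \<in> closure A \<Longrightarrow> y \<in> closure A \<Longrightarrow> S' (x + y) = S' x + S' y"
    and "\<And>c x. x \<in> closure A \<Longrightarrow> S' (c *\<^sub>R x) = c *\<^sub>R S' x"
    and "\<And>x. x \<in> closure A \<Longrightarrow> norm (S' x) = norm x"
proof -
  have "dist (S x) (S y) = dist x y" if "x \<in> A" "y \<in> A" for x y
  proof -
    have "S (x - y) = S x - S y"
      using add[of x "- y"] scale[of y "-1"] that subspace_neg[OF A] by simp
    then show ?thesis
      using norm[of "x - y"] that subspace_diff[OF A] by (simp add: dist_norm)
  qed
  then have "uniformly_continuous_on A S"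
    unfolding uniformly_continuous_on_def by metis
  then obtain S' where S': "uniformly_continuous_on (closure A) S'" "\<And>x. x \<in> A \<Longrightarrow> S x = S' x"
    using uniformly_continuous_on_extension_on_closure by metis
  have lim: "(\<lambda>n. S (u n)) \<longlonglongrightarrow> S' x"
    if "\<And>n. u n \<in> A" "u \<longlonglongrightarrow> x" "x \<in> closure A" for u x
  proof -
    have "(\<lambda>n. S' (u n)) \<longlonglongrightarrow> S' x"
      using continuous_on_tendsto_compose[OF uniformly_continuous_imp_continuous[OF S'(1)] that(2,3)]
        that(1) closure_subset by (meson always_eventually subsetD)
    then show ?thesis using S'(2) that(1) by simp
  qed
  note cl = subspace_closure[OF A]
  show ?thesis
  proof
    show "S' x = S x" if "x \<in> A" for x
      using S'(2) that by simp
    show "S' (x + y) = S' x + S' y" if "x \<in> closure A" "y \<in> closure A" for x y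
    proof -
      obtain u v where u: "\<And>n. u n \<in> A" "u \<longlonglongrightarrow> x" and v: "\<And>n. v n \<in> A" "v \<longlonglongrightarrow> y"
        using \<open>x \<in> closure A\<close> \<open>y \<in> closure A\<close> unfolding closure_sequential by blast
      have "(\<lambda>n. S (u n + v n)) \<longlonglongrightarrow> S' (x + y)"
        using u v that by (intro lim tendsto_add subspace_add A cl)
      moreover have "(\<lambda>n. S (u n + v n)) \<longlonglongrightarrow> S' x + S' y"
        using tendsto_add[OF lim[OF u that(1)] lim[OF v that(2)]] add u v by simp
      ultimately show ?thesis by (rule LIMSEQ_unique)
    qed
    show "S' (c *\<^sub>R x) = c *\<^sub>R S' x" if x: "x \<in> closure A" for c x
    proof -
      obtain u where u: "\<And>n. u n \<in> A" "u \<longlonglongrightarrow> x"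
        using x unfolding closure_sequential by blast
      have "(\<lambda>n. S (c *\<^sub>R u n)) \<longlonglongrightarrow> S' (c *\<^sub>R x)"
        using u x by (intro lim tendsto_scaleR tendsto_const subspace_scale A cl)
      moreover have "(\<lambda>n. S (c *\<^sub>R u n)) \<longlonglongrightarrow> c *\<^sub>R S' x"
        using tendsto_scaleR[OF tendsto_const lim[OF u x]] scale u by simp
      ultimately show ?thesis by (rule LIMSEQ_unique)
    qed
    show "norm (S' x) = norm x" if x: "x \<in> closure A" for x
    proof -
      obtain u where u: "\<And>n. u n \<in> A" "u \<longlonglongrightarrow> x"
        using x unfolding closure_sequential by blast
      have "(\<lambda>n. norm (u n)) \<longlonglongrightarrow> norm (S' x)"
        using tendsto_norm[OF lim[OF u x]] norm u by simp
      moreover have "(\<lambda>n. norm (u n)) \<longlonglongrightarrow> norm x"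
        using u by (intro tendsto_norm)
      ultimately show ?thesis by (rule LIMSEQ_unique)
    qed
  qed
qed

section \<open>Peaking functions at strong boundary points\<close>

text \<open>By the triangle inequality a midpoint of norm 1 forces both endpoints onto the unit
  sphere, where strict convexity leaves no room for two distinct points.\<close>

lemma strictly_convex_midpoint:
  assumes "strictly_convex_space TYPE('f::real_normed_vector)"
    and "norm (u::'f) \<le> 1" "norm v \<le> 1" "norm (midpoint u v) = 1"
  shows "u = v" "norm u = 1"
proof -
  have m: "midpoint u v = (1/2) *\<^sub>R (u + v)"
    by (simp add: midpoint_def)
  have "norm (u + v) = 2"
    using assms(4) unfolding m by simp
  then have *: "norm u = 1" "norm v = 1"
    using norm_triangle_ineq[of u v] assms(2,3) by linarith+
  with assms(1,4) show "u = v"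
    unfolding strictly_convex_space_def m by force
  show "norm u = 1" by fact
qed

lemma bcontfun_norm_attained:
  fixes g :: "'y::topological_space \<Rightarrow>\<^sub>C 'f::real_normed_vector"
  assumes "compact (UNIV :: 'y set)"
  obtains y where "norm (g y) = norm g"
proof -
  obtain y where "\<And>z. norm (g z) \<le> norm (g y)"
    using continuous_attains_sup[OF assms, of "\<lambda>y. norm (g y)"]
    by (auto intro: continuous_intros)
  then have "norm g \<le> norm (g y)"
    by (rule norm_bound)
  then show ?thesis
    using that norm_bounded[of g y] by (meson order_antisym)
qed

lemma bounded_linear_apply_bcontfun:
  "bounded_linear (\<lambda>f :: 'x::topological_space \<Rightarrow>\<^sub>C 'e::real_normed_vector. f z)"
  by (rule bounded_linear_intro[where K = 1]) (simp_all add: norm_bounded)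

lemma midpoint_bcontfun: "apply_bcontfun (midpoint f g) z = midpoint (f z) (g z)"
  by (simp add: midpoint_def)

text \<open>Only the prescribed value of a peaking function matters here, hence the neighborhood
  \<open>UNIV\<close>; scaling handles vectors \<open>e\<close> of arbitrary norm.\<close>

lemma strong_boundary_point_interpolate:
  assumes "subspace D" "strong_boundary_point D x"
  obtains f where "f \<in> D" "apply_bcontfun f x = e" "norm f = norm e"
proof (cases "e = 0")
  case True
  then show ?thesis
    using that[of 0] subspace_0[OF assms(1)] by simp
next
  case False
  then obtain f where "f \<in> D" "norm f = 1" "f x = sgn e"
    using assms(2)[unfolded strong_boundary_point_def, rule_format, of UNIV 1 "sgn e"]
    by (auto simp: norm_sgn)
  with False show ?thesis
    using that[of "norm e *\<^sub>R f"] subspace_scale[OF assms(1)] by (simp add: sgn_div_norm)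
qed

text \<open>
  Additive form of Bishop's peak lemma: \<open>h\<close> is a geometric series of peaking functions, the \<open>n\<close>-th of
  which is small where \<open>f\<close> is not yet smaller than \<open>2\<^bsup>-n-1\<^esup>\<close>. A single such term is enough to push
  \<open>h\<close> far enough below 1 at every point where \<open>f\<close> does not vanish.
\<close>
lemma strong_boundary_point_Bishop:
  fixes D :: "('x::topological_space \<Rightarrow>\<^sub>C 'e::banach) set" and f :: "'x \<Rightarrow>\<^sub>C 'e"
  assumes D: "subspace D" "closed D"
    and x: "strong_boundary_point D x" and u: "norm u = 1"
    and f: "f x = 0" "norm f \<le> 1"
  obtains h where "h \<in> D" "apply_bcontfun h x = u" "norm h \<le> 1" "norm (f + 4 *\<^sub>R h) \<le> 4"
proof -
  \<comment> \<open>The \<open>w n\<close> are both the weights of the series and the thresholds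
    defining \<open>U n\<close>. Their sum 1 yields \<open>h x = u\<close> and
    \<open>norm h \<le> 1\<close>.\<close>
  define w :: "nat \<Rightarrow> real" where "w n = (1/2) ^ Suc n" for n
  have w: "w sums 1" "w n > 0" for n
    unfolding w_def using power_half_series by simp_all
  define U where "U n = {z. norm (f z) < w n}" for n
  have "\<exists>k\<in>D. norm k = 1 \<and> apply_bcontfun k x = u
      \<and> (\<forall>z. z \<notin> U n \<longrightarrow> norm (apply_bcontfun k z) < 1/2)" for n
  proof -
    have "open (U n)"
      unfolding U_def by (intro open_Collect_less continuous_intros) auto
    moreover have "x \<in> U n"
      using w f by (simp add: U_def)
    ultimately show ?thesis
      using x u unfolding strong_boundary_point_def by (meson half_gt_zero zero_less_one)
  qed
  then obtain k :: "nat \<Rightarrow> 'x \<Rightarrow>\<^sub>C 'e" where k: "\<And>n. k n \<in> D" "\<And>n. norm (k n) = 1" "\<And>n. k n x = u"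
      "\<And>n z. z \<notin> U n \<Longrightarrow> norm (k n z) < 1/2"
    by metis
  define s where "s n = w n *\<^sub>R k n" for n
  have "summable (\<lambda>n. norm (s n))"
    using w k(2) sums_summable[OF w(1)] by (simp add: s_def less_imp_le)
  then have s: "s sums suminf s"
    by (rule summable_sums[OF summable_norm_cancel])
  define h where "h = suminf s"
  have ev: "(\<lambda>n. s n z) sums h z" for z
    using bounded_linear.sums[OF bounded_linear_apply_bcontfun s] by (simp add: h_def)
  have le: "norm (s n z) \<le> w n" for n z
    using norm_bounded[of "k n" z] k(2)[of n] w(2)[of n] by (simp add: s_def mult_left_le)
  have h1: "norm (h z) \<le> 1" for z
    using norm_sums_le[OF ev w(1) le] .
  show ?thesis
  proof
    have "(\<Sum>i<n. s i) \<in> D" for n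
      by (intro subspace_sum D) (simp add: s_def subspace_scale D k)
    then show "h \<in> D"
      using s D(2) unfolding sums_def h_def by (meson closed_sequentially)
    have "(\<lambda>n. s n x) sums (1 *\<^sub>R u)"
      using bounded_linear.sums[OF bounded_linear_scaleR_left w(1)] by (simp add: s_def k)
    then show "h x = u"
      using sums_unique2[OF ev[of x]] by simp
    show "norm h \<le> 1"
      using h1 by (rule norm_bound)
    show "norm (f + 4 *\<^sub>R h) \<le> 4"
    proof (rule norm_bound)
      fix z
      have "norm (f z) + 4 * norm (h z) \<le> 4"
      proof (cases "f z = 0")
        case True
        then show ?thesis using h1[of z] by simp
      next
        case False
        define t where "t = norm (f z)"
        have t: "0 < t" "t \<le> 1"
          using False f norm_bounded[of f z] by (auto simp: t_def)
        \<comment> \<open>Minimality of \<open>m\<close> gives \<open>t \<le> 2 * w m\<close> (for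
          \<open>m = 0\<close> because \<open>t \<le> 1\<close>). The \<open>m\<close>-th term falls
          short of its weight by at least \<open>w m / 2\<close>, hence by at least
          \<open>t / 4\<close>; this explains the factor 4.\<close>
        define m where "m = (LEAST m. w m \<le> t)"
        obtain j where "(1/2) ^ j < t"
          using t real_arch_pow_inv[of t "1/2"] by auto
        then have "w j \<le> t"
          using t by (simp add: w_def)
        then have m: "w m \<le> t"
          unfolding m_def by (rule LeastI)
        have "t \<le> 2 * w m"
        proof (cases m)
          case 0
          then show ?thesis using t by (simp add: w_def)
        next
          case (Suc i)
          then have "\<not> w i \<le> t"
            using not_less_Least[of i "\<lambda>m. w m \<le> t"] by (simp add: m_def)
          then show ?thesis
            using Suc by (simp add: w_def)
        qed
        moreover have "norm (h z) \<le> 1 - w m / 2"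
        proof (rule norm_sums_le[OF ev])
          \<comment> \<open>The majorant is the weight series with only its \<open>m\<close>-th term
            halved.\<close>
          show "(\<lambda>n. w n - (if n = m then w n / 2 else 0)) sums (1 - w m / 2)"
            by (intro sums_diff w sums_single)
          have "z \<notin> U m"
            using m by (simp add: U_def t_def)
          then have "norm (s m z) \<le> w m / 2"
            using k(4)[of z m] w(2)[of m] by (simp add: s_def)
          then show "norm (s n z) \<le> w n - (if n = m then w n / 2 else 0)" for n
            using le by simp
        qed
        ultimately show ?thesis
          by (simp add: t_def)
      qed
      then show "norm ((f + 4 *\<^sub>R h) z) \<le> 4"
        using norm_triangle_ineq[of "f z" "4 *\<^sub>R h z"] by simp
    qed
  qed
qed

section \<open>Linear isometries as weighted composition operators\<close>

locale bcontfun_linear_isometry =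
  fixes D :: "('x::t2_space \<Rightarrow>\<^sub>C 'e::banach) set"
    and S :: "('x \<Rightarrow>\<^sub>C 'e) \<Rightarrow> ('y::t2_space \<Rightarrow>\<^sub>C 'f::real_normed_vector)"
  assumes compact_codomain: "compact (UNIV :: 'y set)"
    and strictly_convex: "strictly_convex_space TYPE('f)"
    and subspace: "subspace D" and closed: "closed D"
    and add: "f \<in> D \<Longrightarrow> g \<in> D \<Longrightarrow> S (f + g) = S f + S g"
    and scale: "f \<in> D \<Longrightarrow> S (c *\<^sub>R f) = c *\<^sub>R S f"
    and norm: "f \<in> D \<Longrightarrow> norm (S f) = norm f"
begin

lemma diff: "f \<in> D \<Longrightarrow> g \<in> D \<Longrightarrow> S (f - g) = S f - S g"
  using add[of f "- g"] scale[of g "-1"] subspace_neg[OF subspace] by simp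

lemma norm_apply_le: "f \<in> D \<Longrightarrow> norm (S f y) \<le> norm f"
  using norm norm_bounded by metis

lemma common_value:
  assumes x: "strong_boundary_point D x" and u: "norm u = 1"
  obtains y v where "norm v = 1" "\<And>f. f \<in> D \<Longrightarrow> norm f \<le> 1 \<Longrightarrow> f x = u \<Longrightarrow> S f y = v"
proof -
  \<comment> \<open>\<open>P\<close> is closed under midpoints, and all its members have norm
    exactly 1 because they take the unit vector \<open>u\<close> at \<open>x\<close>.\<close>
  define P where "P = {f \<in> D. norm f \<le> 1 \<and> f x = u}"
  have P: "f \<in> D" "norm (S f) = 1" if "f \<in> P" for f
    using that norm_bounded[of f x] u by (auto simp: P_def norm)
  have P_le: "norm (S f y) \<le> 1" if "f \<in> P" for f y
    using P[OF that] norm_bounded[of "S f" y] by simp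
  have mid: "midpoint f g \<in> P" and S_mid: "S (midpoint f g) y = midpoint (S f y) (S g y)"
    if "f \<in> P" "g \<in> P" for f g y
  proof -
    have "norm (f + g) \<le> 2"
      using that norm_triangle_ineq[of f g] by (simp add: P_def)
    moreover have "f + g \<in> D"
      using that by (simp add: P_def subspace_add subspace)
    ultimately show "midpoint f g \<in> P"
      using that by (simp add: P_def midpoint_bcontfun) (simp add: midpoint_def subspace_scale subspace)
    show "S (midpoint f g) y = midpoint (S f y) (S g y)"
      using \<open>f + g \<in> D\<close> P(1) that by (simp add: midpoint_def scale add)
  qed
  obtain f0 where "f0 \<in> D" "f0 x = u" "norm f0 = norm u"
    using strong_boundary_point_interpolate[OF subspace x] .
  then have f0: "f0 \<in> P"
    using u by (simp add: P_def)
  \<comment> \<open>Averaging finitely many members one midpoint at a time: wherever the image of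
    the average has norm 1, so do the images of all of them. Such a point exists by compactness,
    which gives the finite intersection property below.\<close>
  have fin: "\<exists>g\<in>P. \<forall>y. norm (S g y) = 1 \<longrightarrow> (\<forall>f\<in>Q. norm (S f y) = 1)"
    if "finite Q" "Q \<subseteq> P" for Q
    using that
  proof induction
    case empty
    then show ?case using f0 by auto
  next
    case (insert f Q)
    then obtain g where g: "g \<in> P" "\<And>y. norm (S g y) = 1 \<Longrightarrow> \<forall>f\<in>Q. norm (S f y) = 1"
      by auto
    have "norm (S f y) = 1 \<and> norm (S g y) = 1" if "norm (S (midpoint f g) y) = 1" for y
    proof -
      have f: "f \<in> P"
        using insert.prems by simp
      have "norm (midpoint (S f y) (S g y)) = 1"
        using that S_mid[OF f g(1)] by simp
      with strictly_convex_midpoint[OF strictly_convex P_le[OF f] P_le[OF g(1)]]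
      show ?thesis by metis
    qed
    then have "\<forall>y. norm (S (midpoint f g) y) = 1 \<longrightarrow> (\<forall>f\<in>insert f Q. norm (S f y) = 1)"
      using g(2) by blast
    moreover have "midpoint f g \<in> P"
      using g(1) insert.prems by (simp add: mid)
    ultimately show ?case by (rule bexI)
  qed
  have "UNIV \<inter> (\<Inter>f\<in>P. {y. norm (S f y) = 1}) \<noteq> {}"
  proof (rule compact_imp_fip_image[OF compact_codomain])
    show "closed {y. norm (S f y) = 1}" for f
      by (intro closed_Collect_eq continuous_intros) auto
  next
    fix Q assume "finite Q" "Q \<subseteq> P"
    then obtain g where g: "g \<in> P" "\<And>y. norm (S g y) = 1 \<Longrightarrow> \<forall>f\<in>Q. norm (S f y) = 1"
      using fin by meson
    obtain y where "norm (S g y) = norm (S g)"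
      using bcontfun_norm_attained[OF compact_codomain] .
    then show "UNIV \<inter> (\<Inter>f\<in>Q. {y. norm (S f y) = 1}) \<noteq> {}"
      using g(2)[of y] P(2)[OF g(1)] by auto
  qed
  then obtain y where y: "\<And>f. f \<in> P \<Longrightarrow> norm (S f y) = 1"
    by auto
  \<comment> \<open>The midpoint of \<open>f\<close> and \<open>f0\<close> is again in
    \<open>P\<close>, so its image also has norm 1 at \<open>y\<close>, and strict convexity
    applies.\<close>
  have "S f y = S f0 y" if "f \<in> P" for f
    using strictly_convex_midpoint(1)[OF strictly_convex P_le[OF that] P_le[OF f0]]
      y[OF mid[OF that f0]] S_mid[OF that f0] by simp
  with y[OF f0] show ?thesis
    by (intro that[of "S f0 y" y]) (auto simp: P_def)
qed

lemma vanishing: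
  assumes x: "strong_boundary_point D x" and u: "norm u = 1"
    and v: "\<And>f. f \<in> D \<Longrightarrow> norm f \<le> 1 \<Longrightarrow> f x = u \<Longrightarrow> S f y = v"
    and f: "f \<in> D" "f x = 0"
  shows "S f y = 0"
proof (cases "f = 0")
  case True
  then show ?thesis using scale[of f 0] f by simp
next
  case False
  define f' where "f' = sgn f"
  have f': "f' \<in> D" "f' x = 0" "norm f' \<le> 1"
    using f False by (simp_all add: f'_def sgn_div_norm subspace_scale subspace)
  obtain h where h: "h \<in> D" "h x = u" "norm h \<le> 1" "norm (f' + 4 *\<^sub>R h) \<le> 4"
    using strong_boundary_point_Bishop[OF subspace closed x u f'(2,3)] .
  have mem: "4 *\<^sub>R h \<in> D" "f' + 4 *\<^sub>R h \<in> D"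
    using f' h by (simp_all add: subspace_add subspace_scale subspace)
  \<comment> \<open>The function \<open>h + f' / 4\<close> has norm at most 1 by the choice of
    \<open>h\<close>, and it still takes the value \<open>u\<close> at \<open>x\<close> because
    \<open>f'\<close> vanishes there.\<close>
  have "S ((1/4) *\<^sub>R (f' + 4 *\<^sub>R h)) y = v"
    using h f' mem by (intro v) (simp_all add: subspace_scale subspace)
  moreover have "S ((1/4) *\<^sub>R (f' + 4 *\<^sub>R h)) y = (1/4) *\<^sub>R S f' y + S h y"
    by (simp only: scale[OF mem(2)] add[OF f'(1) mem(1)] scale[OF h(1)])
      (simp add: scaleR_right_distrib)
  moreover have "S h y = v"
    using h v by blast
  ultimately have "S f' y = 0" by simp
  then show ?thesis
    using f False by (simp add: f'_def sgn_div_norm scale)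
qed

text \<open>A relation instead of a pair of functions, so that \<open>Y0\<close> can consist of
  every \<open>y\<close> that has some partner; uniqueness of \<open>x\<close> is proved
  afterwards.\<close>

definition represents :: "'y \<Rightarrow> 'x \<Rightarrow> ('e \<Rightarrow>\<^sub>L 'f) \<Rightarrow> bool" where
  "represents y x V \<longleftrightarrow>
     strong_boundary_point D x \<and> norm V = 1 \<and> (\<forall>f\<in>D. S f y = blinfun_apply V (f x))"

text \<open>Functions vanishing at \<open>x\<close> have images vanishing at \<open>y\<close>, so
  \<open>S f y\<close> factors through \<open>f x\<close>. Norm-preserving interpolation bounds the
  factor by 1, and the unit vectors \<open>u\<close> and \<open>v\<close> show that the bound is
  attained.\<close>

lemma represents_exists:
  assumes x: "strong_boundary_point D x" and "\<exists>u::'e. u \<noteq> 0"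
  obtains y V where "represents y x V"
proof -
  obtain u :: 'e where u: "norm u = 1"
  proof -
    obtain w :: 'e where "w \<noteq> 0" using assms(2) by blast
    then have "norm (sgn w) = 1" by (simp add: norm_sgn)
    then show ?thesis by (rule that)
  qed
  obtain y v where v: "norm v = 1" "\<And>f. f \<in> D \<Longrightarrow> norm f \<le> 1 \<Longrightarrow> f x = u \<Longrightarrow> S f y = v"
    using common_value[OF x u] by blast
  have vanish: "S f y = 0" if "f \<in> D" "f x = 0" for f
    using vanishing[OF x u v(2) that] .
  have "\<exists>f\<in>D. apply_bcontfun f x = e \<and> norm f = norm e" for e
    using strong_boundary_point_interpolate[OF subspace x, of e] by metis
  \<comment> \<open>\<open>k\<close> is an arbitrary right inverse of evaluation at
    \<open>x\<close>. It need not be linear; \<open>L\<close> is, because it does not depend on the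
    choice of \<open>k\<close>.\<close>
  then obtain k :: "'e \<Rightarrow> 'x \<Rightarrow>\<^sub>C 'e" where k: "\<And>e. k e \<in> D" "\<And>e. k e x = e" "\<And>e. norm (k e) = norm e"
    by metis
  define L where "L e = S (k e) y" for e
  have L: "S f y = L (f x)" if "f \<in> D" for f
    using vanish[of "f - k (f x)"] diff[OF that k(1)] that k
    by (simp add: L_def subspace_diff subspace)
  have bound: "norm (L e) \<le> norm e" for e
    using norm_apply_le[OF k(1)] k(3) unfolding L_def by metis
  have "bounded_linear L"
  proof (rule bounded_linear_intro[where K = 1])
    show "L (a + b) = L a + L b" for a b
      using L[of "k a + k b"] add[OF k(1) k(1), of a b] k
      by (simp add: L_def subspace_add subspace)
    show "L (c *\<^sub>R a) = c *\<^sub>R L a" for c a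
      using L[of "c *\<^sub>R k a"] scale[OF k(1), of c a] k
      by (simp add: L_def subspace_scale subspace)
  qed (simp add: bound)
  then have V: "blinfun_apply (Blinfun L) = L"
    by (rule bounded_linear_Blinfun_apply)
  have "norm (Blinfun L) \<le> 1"
    by (rule norm_blinfun_bound) (simp_all add: V bound)
  moreover have "norm (L u) = 1"
    using v k u by (simp add: L_def)
  then have "1 \<le> norm (Blinfun L)"
    using norm_blinfun[of "Blinfun L" u] u by (simp add: V)
  ultimately have "represents y x (Blinfun L)"
    using x L by (simp add: represents_def V)
  then show ?thesis by (rule that)
qed

text \<open>Since \<open>V\<close> has norm 1, some unit vector \<open>u\<close> satisfies
  \<open>1/2 < norm (V u)\<close>. Take \<open>f\<close> peaking at \<open>x\<close> with value
  \<open>u\<close> and smaller than 1/2 off \<open>U\<close>: the image of \<open>f\<close> exceeds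
  1/2 near \<open>y\<close>, which excludes partners outside \<open>U\<close>. This yields both
  uniqueness and continuity.\<close>

lemma represents_nearby:
  assumes "represents y x V" "open U" "x \<in> U"
  obtains W where "open W" "y \<in> W" "\<And>y' x' V'. y' \<in> W \<Longrightarrow> represents y' x' V' \<Longrightarrow> x' \<in> U"
proof -
  have V: "norm V = 1" "\<And>f. f \<in> D \<Longrightarrow> S f y = V (f x)"
    using assms by (auto simp: represents_def)
  obtain u where u: "norm u = 1" "1/2 < norm (V u)"
  proof -
    have "\<not> (\<forall>e. norm (V e) \<le> 1/2 * norm e)"
    proof
      assume "\<forall>e. norm (V e) \<le> 1/2 * norm e"
      then have "norm V \<le> 1/2"
        by (intro norm_blinfun_bound) auto
      with V(1) show False by simp
    qed
    then obtain e where e: "1/2 * norm e < norm (V e)"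
      by (meson not_le)
    then have "e \<noteq> 0" by auto
    then have "norm (sgn e) = 1" "1/2 < norm (V (sgn e))"
      using e by (simp_all add: norm_sgn sgn_div_norm blinfun.scaleR_right field_simps)
    then show ?thesis by (rule that)
  qed
  obtain f where f: "f \<in> D" "norm f = 1" "f x = u" "\<And>z. z \<notin> U \<Longrightarrow> norm (f z) < 1/2"
    using assms u(1) unfolding represents_def strong_boundary_point_def
    by (meson half_gt_zero zero_less_one)
  show ?thesis
  proof
    show "open {y. 1/2 < norm (S f y)}"
      by (intro open_Collect_less continuous_intros) auto
    show "y \<in> {y. 1/2 < norm (S f y)}"
      using u f V(2) by simp
    show "x' \<in> U" if "y' \<in> {y. 1/2 < norm (S f y)}" "represents y' x' V'" for y' x' V'
    proof (rule ccontr)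
      assume "x' \<notin> U"
      then have "norm (V' (f x')) < 1/2"
        using f(4) norm_blinfun[of V' "f x'"] that(2) by (force simp: represents_def)
      then show False
        using that f(1) by (simp add: represents_def)
    qed
  qed
qed

lemma represents_unique:
  assumes "represents y x V" "represents y x' V'"
  shows "x = x'"
proof (rule ccontr)
  assume "x \<noteq> x'"
  then obtain U where "open U" "x \<in> U" "x' \<notin> U"
    by (meson t1_space)
  then show False
    using represents_nearby[OF assms(1)] assms(2) by metis
qed

theorem weighted_composition:
  assumes "\<exists>u::'e. u \<noteq> 0"
  obtains Y0 :: "'y set" and \<Phi> :: "'y \<Rightarrow> 'x" and V :: "'y \<Rightarrow> 'e \<Rightarrow>\<^sub>L 'f"
  where "continuous_on Y0 \<Phi>" "\<Phi> ` Y0 = strong_boundary D" "\<And>y. y \<in> Y0 \<Longrightarrow> norm (V y) = 1"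
    "\<And>f y. f \<in> D \<Longrightarrow> y \<in> Y0 \<Longrightarrow> S f y = V y (f (\<Phi> y))"
proof -
  define Y0 where "Y0 = {y. \<exists>x V. represents y x V}"
  have "\<forall>y\<in>Y0. \<exists>x V. represents y x V"
    by (simp add: Y0_def)
  then obtain \<Phi> V where rep: "\<And>y. y \<in> Y0 \<Longrightarrow> represents y (\<Phi> y) (V y)"
    by metis
  show ?thesis
  proof
    show "continuous_on Y0 \<Phi>"
      unfolding continuous_on_topological
    proof safe
      fix y U assume "y \<in> Y0" "open U" "\<Phi> y \<in> U"
      then show "\<exists>W. open W \<and> y \<in> W \<and> (\<forall>y'\<in>Y0. y' \<in> W \<longrightarrow> \<Phi> y' \<in> U)"
        using represents_nearby[OF rep] rep by metis
    qed
    show "\<Phi> ` Y0 = strong_boundary D"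
    proof
      show "\<Phi> ` Y0 \<subseteq> strong_boundary D"
        using rep by (auto simp: represents_def strong_boundary_def)
      show "strong_boundary D \<subseteq> \<Phi> ` Y0"
      proof
        fix x assume "x \<in> strong_boundary D"
        then obtain y V' where y: "represents y x V'"
          using represents_exists[OF _ assms] by (auto simp: strong_boundary_def)
        then have "y \<in> Y0" by (auto simp: Y0_def)
        \<comment> \<open>The chosen point \<open>\<Phi> y\<close> could a priori differ from
          \<open>x\<close>; uniqueness identifies them.\<close>
        with y show "x \<in> \<Phi> ` Y0"
          using rep represents_unique by blast
      qed
    qed
  qed (use rep in \<open>auto simp: represents_def\<close>)
qed

end

section \<open>Surjective isometries\<close>

text \<open>Passes to the real structure, in which the Mazur-Ulam theorem and the operators
  \<open>V y\<close> live.\<close>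

lemma subspace_bcontfun_scale:
  assumes "normed_space_over scl" "module.subspace (bcontfun_scale scl) A"
  shows "subspace A"
proof -
  interpret normed_space_over scl by fact
  interpret bcf: vector_space "bcontfun_scale scl"
    by (rule vector_space_bcontfun_scale)
  have "bcontfun_scale scl (of_real r) f = r *\<^sub>R f" for r f
    by (rule bcontfun_eqI) (simp add: apply_bcontfun_scale scale_of_real)
  then show ?thesis
    using assms unfolding bcf.subspace_def real_vector.subspace_def by metis
qed

section \<open>Constant functions\<close>

lemma const_bcontfun_add: "const_bcontfun a + const_bcontfun b = const_bcontfun (a + b)"
  by (rule bcontfun_eqI) simp

lemma const_bcontfun_scaleR: "c *\<^sub>R const_bcontfun a = const_bcontfun (c *\<^sub>R a)"
  by (rule bcontfun_eqI) simp

lemma const_bcontfun_inject: "const_bcontfun a = const_bcontfun b \<longleftrightarrow> a = b"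
  by (metis const_bcontfun.rep_eq)

lemma norm_const_bcontfun: "norm (const_bcontfun u :: 'x::topological_space \<Rightarrow>\<^sub>C 'e::real_normed_vector) = norm u"
proof (rule antisym)
  show "norm (const_bcontfun u :: 'x \<Rightarrow>\<^sub>C 'e) \<le> norm u"
    by (rule norm_bound) simp
  show "norm u \<le> norm (const_bcontfun u :: 'x \<Rightarrow>\<^sub>C 'e)"
    using norm_bounded[of "const_bcontfun u :: 'x \<Rightarrow>\<^sub>C 'e"] by simp
qed

theorem theorem3p5:
  fixes scaleE :: "'k::real_or_complex \<Rightarrow> 'e::banach \<Rightarrow> 'e"
    and scaleF :: "'k \<Rightarrow> 'f::banach \<Rightarrow> 'f"
    and A :: "('x::t2_space \<Rightarrow>\<^sub>C 'e) set"
    and B :: "('y::t2_space \<Rightarrow>\<^sub>C 'f) set"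
    and T :: "('x \<Rightarrow>\<^sub>C 'e) \<Rightarrow> ('y \<Rightarrow>\<^sub>C 'f)"
  assumes "compact (UNIV :: 'x set)" and "compact (UNIV :: 'y set)"
    and "normed_space_over scaleE" and "normed_space_over scaleF"
    and "\<exists>u::'e. u \<noteq> 0" and "\<exists>v::'f. v \<noteq> 0"
    and "strictly_convex_space TYPE('f)"
    and "module.subspace (bcontfun_scale scaleE) A"
    and "module.subspace (bcontfun_scale scaleF) B"
    and "T ` A = B"
    and "\<forall>f\<in>A. \<forall>g\<in>A. norm (T f - T g) = norm (f - g)"
  shows "\<exists>(Y0 :: 'y set) (\<Phi> :: 'y \<Rightarrow> 'x) (V :: 'y \<Rightarrow> 'e \<Rightarrow>\<^sub>L 'f).
      continuous_on Y0 \<Phi> \<and> \<Phi> ` Y0 = strong_boundary (closure A)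
      \<and> (\<forall>y\<in>Y0. norm (V y) = 1)
      \<and> (\<forall>f\<in>A. \<forall>y\<in>Y0. apply_bcontfun (T f) y =
            apply_bcontfun (T 0) y + blinfun_apply (V y) (apply_bcontfun f (\<Phi> y)))
      \<and> (contains_constants A \<longrightarrow>
            continuous_map (top_of_set Y0) strong_operator_topology V)
      \<and> (contains_constants A \<and> contains_constants B
            \<and> (\<forall>u. \<exists>v. T (const_bcontfun u) = const_bcontfun v) \<longrightarrow>
            (\<exists>W :: 'e \<Rightarrow>\<^sub>L 'f. (\<forall>u. norm (blinfun_apply W u) = norm u) \<and> (\<forall>y\<in>Y0. V y = W)))"
proof -
  have A: "subspace A" and B: "subspace B"
    using subspace_bcontfun_scale assms by blast+
  define S where "S f = T f - T 0" for f
  have "S ` A = B"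
  proof
    show "S ` A \<subseteq> B"
      using assms(10) A B by (auto simp: S_def subspace_diff subspace_0)
    show "B \<subseteq> S ` A"
    proof
      fix b assume "b \<in> B"
      then have "b + T 0 \<in> T ` A"
        using assms(10) A B by (auto simp: subspace_add subspace_0)
      then show "b \<in> S ` A"
        by (auto simp: S_def image_iff algebra_simps)
    qed
  qed
  then have iso: "isometry_betw S A B"
    using assms(11) by (simp add: isometry_betw_def dist_norm S_def)
  have S0: "S 0 = 0"
    by (simp add: S_def)
  note S_add = Mazur_Ulam(1)[OF A B iso S0] and S_scale = Mazur_Ulam(2)[OF A B iso S0]
  have S_norm: "norm (S f) = norm f" if "f \<in> A" for f
    using isometry_betw_dist[OF iso that subspace_0[OF A]] S0 by simp
  obtain S' where S': "\<And>f. f \<in> A \<Longrightarrow> S' f = S f"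
      "\<And>f g. f \<in> closure A \<Longrightarrow> g \<in> closure A \<Longrightarrow> S' (f + g) = S' f + S' g"
      "\<And>c f. f \<in> closure A \<Longrightarrow> S' (c *\<^sub>R f) = c *\<^sub>R S' f"
      "\<And>f. f \<in> closure A \<Longrightarrow> norm (S' f) = norm f"
    using linear_isometry_extend_closure[where S = S, OF A S_add S_scale S_norm] by metis
  interpret bcontfun_linear_isometry "closure A" S'
    by unfold_locales (simp_all add: assms S' subspace_closure A)
  obtain Y0 \<Phi> and V :: "'y \<Rightarrow> 'e \<Rightarrow>\<^sub>L 'f" where
      \<Phi>: "continuous_on Y0 \<Phi>" "\<Phi> ` Y0 = strong_boundary (closure A)"
    and V: "\<And>y. y \<in> Y0 \<Longrightarrow> norm (V y) = 1"
      "\<And>f y. f \<in> closure A \<Longrightarrow> y \<in> Y0 \<Longrightarrow> S' f y = V y (f (\<Phi> y))"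
    by (rule weighted_composition[OF assms(5)]) blast
  have SV: "S f y = V y (f (\<Phi> y))" if "f \<in> A" "y \<in> Y0" for f y
    using V(2) S'(1) that closure_subset by (metis subsetD)
  \<comment> \<open>Testing on constants removes \<open>\<Phi>\<close> from the formula, so
    \<open>V y u\<close> depends on \<open>y\<close> through a single continuous function.\<close>
  have const: "V y u = S (const_bcontfun u) y" if "contains_constants A" "y \<in> Y0" for y u
    using SV[of "const_bcontfun u" y] that by (simp add: contains_constants_def)
  have i: "continuous_map (top_of_set Y0) strong_operator_topology V" if "contains_constants A"
    unfolding continuous_on_strong_operator_topo_iff_coordinatewise
  proof
    fix u
    have "continuous_on Y0 (\<lambda>y. V y u) \<longleftrightarrow> continuous_on Y0 (\<lambda>y. S (const_bcontfun u) y)"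
      using const[OF that] by (intro continuous_on_cong) auto
    then show "continuous_map (top_of_set Y0) euclidean (\<lambda>y. V y u)"
      by simp
  qed
  have ii: "\<exists>W :: 'e \<Rightarrow>\<^sub>L 'f. (\<forall>u. norm (blinfun_apply W u) = norm u) \<and> (\<forall>y\<in>Y0. V y = W)"
    if cA: "contains_constants A" and T: "\<forall>u. \<exists>v. T (const_bcontfun u) = const_bcontfun v"
  proof -
    have mem: "const_bcontfun u \<in> A" for u
      using cA by (simp add: contains_constants_def)
    \<comment> \<open>\<open>T 0\<close> is itself the image of the constant 0, so subtracting it
      keeps constants constant.\<close>
    have "\<exists>v. S (const_bcontfun u) = const_bcontfun v" for u
    proof -
      obtain v v0 where "T (const_bcontfun u) = const_bcontfun v" "T (const_bcontfun 0) = const_bcontfun v0"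
        using T by meson
      then have "S (const_bcontfun u) = const_bcontfun (v - v0)"
        by (intro bcontfun_eqI) (simp add: S_def)
      then show ?thesis ..
    qed
    then obtain w where w: "\<And>u. S (const_bcontfun u) = const_bcontfun (w u)"
      by metis
    have norm_w: "norm (w u) = norm u" for u
      using S_norm[OF mem, of u] by (simp add: w norm_const_bcontfun)
    have "bounded_linear w"
    proof (rule bounded_linear_intro[where K = 1])
      fix a b c
      \<comment> \<open>Constants embed linearly and injectively, so \<open>w\<close> inherits the
        linearity of \<open>S\<close>.\<close>
      have "const_bcontfun (w (a + b)) = const_bcontfun (w a) + (const_bcontfun (w b) :: 'y \<Rightarrow>\<^sub>C 'f)"
        using S_add[OF mem[of a] mem[of b]] by (simp only: w const_bcontfun_add)
      then show "w (a + b) = w a + w b"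
        by (metis const_bcontfun_add const_bcontfun_inject)
      have "const_bcontfun (w (c *\<^sub>R a)) = c *\<^sub>R (const_bcontfun (w a) :: 'y \<Rightarrow>\<^sub>C 'f)"
        using S_scale[OF mem[of a], of c] by (simp only: w const_bcontfun_scaleR)
      then show "w (c *\<^sub>R a) = c *\<^sub>R w a"
        by (metis const_bcontfun_scaleR const_bcontfun_inject)
    qed (simp add: norm_w)
    then have W: "blinfun_apply (Blinfun w) = w"
      by (rule bounded_linear_Blinfun_apply)
    \<comment> \<open>The common operator is built from \<open>w\<close> and not from some
      \<open>V y\<close>, so it exists even if \<open>Y0\<close> is empty.\<close>
    have "V y = Blinfun w" if "y \<in> Y0" for y
      by (rule blinfun_eqI) (simp add: W const[OF cA that] w)
    with W norm_w show ?thesis by metis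
  qed
  have "T f y = T 0 y + V y (f (\<Phi> y))" if "f \<in> A" "y \<in> Y0" for f y
    using SV[OF that] by (simp add: S_def algebra_simps)
  then show ?thesis
    using \<Phi> V(1) i ii by (intro exI[of _ Y0] exI[of _ \<Phi>] exI[of _ V]) blast
qed

end
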